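(* Let $(P,\omega)$ be a symplectic manifold, $H\colon P\to\mathbb{R}$ a smooth function with Hamiltonian vector field $Z$, and let $\pi\colon P\to M$ be a fibre bundle. Let $\alpha\colon M\to P$ be a section of $\pi$, and define the vector field $X=T\pi\circ Z\circ\alpha$ on $M$. Suppose that the fibres of $\pi$ are isotropic submanifolds of $(P,\omega)$. Then $\alpha$ is a slicing section for $Z$ if and only if $$i_X\,\alpha^*(\omega)-\mathrm{d}\,\alpha^*(H)=0.$$
   Context: All manifolds and maps are $C^\infty$. The Hamiltonian vector field $Z$ of $H$ is defined by $i_Z\omega=\mathrm{d}H$. A submanifold of $P$ is isotropic if $\omega$ vanishes on every pair of vectors tangent to it at the same point. A section $\alpha$ of $\pi$ (i.e. $\pi\circ\alpha=\mathrm{Id}_M$) is a slicing section for $Z$ if there is a vector field $X$ on $M$ such that $T\alpha\circ X=Z\circ\alpha$; composing with $T\pi$ shows that necessarily $X=T\pi\circ Z\circ\alpha$. Here $\alpha^*(H)=H\circ\alpha$. *)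

theory Defs
  imports "HOL-Analysis.Analysis"
begin

section \<open>Model spaces\<close>

text \<open>Manifolds are modelled on finite-dimensional real inner product spaces. In contrast to
  \<^class>\<open>euclidean_space\<close>, dimension 0 is allowed (it occurs as the dimension of the
  fibres of a covering map).\<close>

class fin_dim_inner = real_inner +
  assumes finite_spanning: "\<exists>B. finite B \<and> (\<forall>x. \<exists>r. x = (\<Sum>b\<in>B. r b *\<^sub>R b))"

instance euclidean_space \<subseteq> fin_dim_inner
proof
  have "\<exists>r. x = (\<Sum>b\<in>Basis. r b *\<^sub>R b)" for x :: 'a
    by (metis euclidean_representation)
  then show "\<exists>B::'a set. finite B \<and> (\<forall>x. \<exists>r. x = (\<Sum>b\<in>B. r b *\<^sub>R b))"
    using finite_Basis by blast
qed

instance prod :: (fin_dim_inner, fin_dim_inner) fin_dim_inner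
proof
  obtain B :: "'a set" where B: "finite B" "\<And>x. \<exists>r. x = (\<Sum>b\<in>B. r b *\<^sub>R b)"
    using finite_spanning by blast
  obtain C :: "'b set" where C: "finite C" "\<And>y. \<exists>r. y = (\<Sum>c\<in>C. r c *\<^sub>R c)"
    using finite_spanning by blast
  define D where "D = (\<lambda>b::'a. (b, 0::'b)) ` B \<union> (\<lambda>c::'b. (0::'a, c)) ` C"
  have fin: "finite D" using B(1) C(1) by (simp add: D_def)
  have "z \<in> span D" for z :: "'a \<times> 'b"
  proof -
    obtain r where r: "fst z = (\<Sum>b\<in>B. r b *\<^sub>R b)" using B(2) by blast
    obtain s where s: "snd z = (\<Sum>c\<in>C. s c *\<^sub>R c)" using C(2) by blast
    have "z = (\<Sum>b\<in>B. r b *\<^sub>R (b, 0)) + (\<Sum>c\<in>C. s c *\<^sub>R (0, c))"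
      by (rule prod_eqI) (simp_all add: r s fst_sum snd_sum)
    also have "\<dots> \<in> span D"
      by (intro span_add span_sum span_scale span_base) (auto simp: D_def)
    finally show ?thesis .
  qed
  then have "\<exists>r. z = (\<Sum>d\<in>D. r d *\<^sub>R d)" for z
    using span_finite[OF fin] by blast
  with fin show "\<exists>D::('a \<times> 'b) set. finite D \<and> (\<forall>z. \<exists>r. z = (\<Sum>d\<in>D. r d *\<^sub>R d))"
    by blast
qed


section \<open>Smooth functions between model spaces\<close>

text \<open>Only used for open \<open>S\<close>. By finite-dimensionality, continuity of all iterated directional
  derivatives is the usual notion of continuous differentiability of order \<open>k\<close>.\<close>

primrec Ck_on :: "nat \<Rightarrow> 'a::real_normed_vector set \<Rightarrow> ('a \<Rightarrow> 'b::real_normed_vector) \<Rightarrow> bool" where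
  "Ck_on 0 S f \<longleftrightarrow> continuous_on S f"
| "Ck_on (Suc k) S f \<longleftrightarrow> (\<forall>x\<in>S. f differentiable (at x)) \<and>
     (\<forall>v. Ck_on k S (\<lambda>x. frechet_derivative f (at x) v))"

definition smooth_on :: "'a::real_normed_vector set \<Rightarrow> ('a \<Rightarrow> 'b::real_normed_vector) \<Rightarrow> bool" where
  "smooth_on S f \<longleftrightarrow> (\<forall>k. Ck_on k S f)"


section \<open>Smooth manifolds\<close>

text \<open>A manifold is a type of points together with an atlas. The atlas need not be maximal; all
  notions below are, up to canonical identification, independent of the choice of the atlas
  within its equivalence class.
  The values of \<open>cmap c\<close> outside \<open>cdom c\<close> are irrelevant.\<close>

datatype ('p, 'e) chart = Chart (cdom: "'p set") (cmap: "'p \<Rightarrow> 'e")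

definition cinv :: "('p, 'e) chart \<Rightarrow> 'e \<Rightarrow> 'p" where
  "cinv c = inv_into (cdom c) (cmap c)"

definition cimg :: "('p, 'e) chart \<Rightarrow> 'e set" where
  "cimg c = cmap c ` cdom c"

definition is_chart :: "('p::topological_space, 'e::fin_dim_inner) chart \<Rightarrow> bool" where
  "is_chart c \<longleftrightarrow> open (cdom c) \<and> open (cimg c) \<and>
     homeomorphism (cdom c) (cimg c) (cmap c) (cinv c)"

definition transition :: "('p, 'e) chart \<Rightarrow> ('p, 'e) chart \<Rightarrow> 'e \<Rightarrow> 'e" where
  "transition c d = cmap d \<circ> cinv c"

definition compatible :: "('p, 'e::fin_dim_inner) chart \<Rightarrow> ('p, 'e) chart \<Rightarrow> bool" where
  "compatible c d \<longleftrightarrow> smooth_on (cmap c ` (cdom c \<inter> cdom d)) (transition c d) \<and>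
     smooth_on (cmap d ` (cdom c \<inter> cdom d)) (transition d c)"

definition smooth_manifold ::
    "('p::{t2_space, second_countable_topology}, 'e::fin_dim_inner) chart set \<Rightarrow> bool" where
  "smooth_manifold A \<longleftrightarrow> (\<forall>c\<in>A. is_chart c) \<and> (\<Union>c\<in>A. cdom c) = UNIV \<and>
     (\<forall>c\<in>A. \<forall>d\<in>A. compatible c d)"

definition maximal_atlas ::
    "('p::topological_space, 'e::fin_dim_inner) chart set \<Rightarrow> ('p, 'e) chart set" where
  "maximal_atlas A = {c. is_chart c \<and> (\<forall>d\<in>A. compatible c d)}"

definition chart_at :: "('p, 'e) chart set \<Rightarrow> 'p \<Rightarrow> ('p, 'e) chart" where
  "chart_at A p = (SOME c. c \<in> A \<and> p \<in> cdom c)"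

definition std_atlas :: "('e, 'e) chart set" where
  "std_atlas = {Chart UNIV id}"

definition prod_atlas ::
    "('p, 'e) chart set \<Rightarrow> ('q, 'f) chart set \<Rightarrow> ('p \<times> 'q, 'e \<times> 'f) chart set" where
  "prod_atlas A B = (\<lambda>(c, d). Chart (cdom c \<times> cdom d) (map_prod (cmap c) (cmap d))) ` (A \<times> B)"

text \<open>Smoothness of a map on an open set \<open>S\<close>.\<close>

definition smooth_map_on ::
    "('p::topological_space, 'e::fin_dim_inner) chart set \<Rightarrow>
     ('q::topological_space, 'f::fin_dim_inner) chart set \<Rightarrow> 'p set \<Rightarrow> ('p \<Rightarrow> 'q) \<Rightarrow> bool" where
  "smooth_map_on A B S f \<longleftrightarrow> continuous_on S f \<and>
     (\<forall>c\<in>A. \<forall>d\<in>B. smooth_on (cmap c ` (cdom c \<inter> S \<inter> f -` cdom d)) (cmap d \<circ> f \<circ> cinv c))"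

abbreviation smooth_map ::
    "('p::topological_space, 'e::fin_dim_inner) chart set \<Rightarrow>
     ('q::topological_space, 'f::fin_dim_inner) chart set \<Rightarrow> ('p \<Rightarrow> 'q) \<Rightarrow> bool" where
  "smooth_map A B \<equiv> smooth_map_on A B UNIV"

abbreviation smooth_function ::
    "('p::topological_space, 'e::fin_dim_inner) chart set \<Rightarrow> ('p \<Rightarrow> real) \<Rightarrow> bool" where
  "smooth_function A \<equiv> smooth_map A std_atlas"


section \<open>Tangent bundle\<close>

text \<open>A tangent vector consists of its base point \<open>p\<close> and, for every chart of the atlas around
  \<open>p\<close>, a coordinate vector, these being related by the derivatives of the transition maps.
  The value at all other charts is fixed to 0, so that equality of tangent vectors is equality.\<close>

type_synonym ('p, 'e) tvec = "'p \<times> (('p, 'e) chart \<Rightarrow> 'e)"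

definition tangent_space ::
    "('p, 'e::fin_dim_inner) chart set \<Rightarrow> 'p \<Rightarrow> ('p, 'e) tvec set" where
  "tangent_space A p = {(p, v) | v.
     (\<forall>c\<in>A. \<forall>d\<in>A. p \<in> cdom c \<inter> cdom d \<longrightarrow>
        v d = frechet_derivative (transition c d) (at (cmap c p)) (v c)) \<and>
     (\<forall>c. \<not> (c \<in> A \<and> p \<in> cdom c) \<longrightarrow> v c = 0)}"

definition tangent_bundle :: "('p, 'e::fin_dim_inner) chart set \<Rightarrow> ('p, 'e) tvec set" where
  "tangent_bundle A = (\<Union>p. tangent_space A p)"

text \<open>The tangent vector at \<open>p\<close> with coordinates \<open>a\<close> in the chart \<open>c\<close>.\<close>

definition coord_tvec ::
    "('p, 'e::fin_dim_inner) chart set \<Rightarrow> ('p, 'e) chart \<Rightarrow> 'p \<Rightarrow> 'e \<Rightarrow> ('p, 'e) tvec" where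
  "coord_tvec A c p a = (p, \<lambda>d. if d \<in> A \<and> p \<in> cdom d
     then frechet_derivative (transition c d) (at (cmap c p)) a else 0)"

text \<open>By the chain rule, on tangent vectors the following does not depend on the chosen chart
  around the base point.\<close>

definition tangent_map ::
    "('p, 'e::fin_dim_inner) chart set \<Rightarrow> ('q, 'f::fin_dim_inner) chart set \<Rightarrow>
     ('p \<Rightarrow> 'q) \<Rightarrow> ('p, 'e) tvec \<Rightarrow> ('q, 'f) tvec" where
  "tangent_map A B f u = (let p = fst u; c = chart_at A p in
     (f p, \<lambda>d. if d \<in> B \<and> f p \<in> cdom d
        then frechet_derivative (cmap d \<circ> f \<circ> cinv c) (at (cmap c p)) (snd u c) else 0))"

definition vector_field ::
    "('p, 'e::fin_dim_inner) chart set \<Rightarrow> ('p \<Rightarrow> ('p, 'e) tvec) \<Rightarrow> bool" where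
  "vector_field A X \<longleftrightarrow> (\<forall>p. X p \<in> tangent_space A p) \<and>
     (\<forall>c\<in>A. smooth_on (cimg c) (\<lambda>y. snd (X (cinv c y)) c))"


section \<open>Differential forms\<close>

definition differential ::
    "('p, 'e::fin_dim_inner) chart set \<Rightarrow> ('p \<Rightarrow> real) \<Rightarrow> ('p, 'e) tvec \<Rightarrow> real" where
  "differential A h u = snd (tangent_map A std_atlas h u) (Chart UNIV id)"

text \<open>A 2-form is a real function of two tangent vectors; only its values on pairs of tangent
  vectors with the same base point matter.\<close>

type_synonym ('p, 'e) form2 = "('p, 'e) tvec \<Rightarrow> ('p, 'e) tvec \<Rightarrow> real"

definition local_rep ::
    "('p, 'e::fin_dim_inner) chart set \<Rightarrow> ('p, 'e) form2 \<Rightarrow> ('p, 'e) chart \<Rightarrow> 'e \<Rightarrow> 'e \<Rightarrow> 'e \<Rightarrow> real"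
  where
  "local_rep A \<omega> c y a b = \<omega> (coord_tvec A c (cinv c y) a) (coord_tvec A c (cinv c y) b)"

definition two_form :: "('p, 'e::fin_dim_inner) chart set \<Rightarrow> ('p, 'e) form2 \<Rightarrow> bool" where
  "two_form A \<omega> \<longleftrightarrow> (\<forall>c\<in>A.
     (\<forall>y\<in>cimg c. bilinear (local_rep A \<omega> c y) \<and> (\<forall>a. local_rep A \<omega> c y a a = 0)) \<and>
     (\<forall>a b. smooth_on (cimg c) (\<lambda>y. local_rep A \<omega> c y a b)))"

text \<open>The exterior derivative of \<open>\<omega>\<close> in the chart \<open>c\<close>: the invariant formula for
  \<open>(d\<omega>)(a, b, e)\<close> for constant (hence commuting) coordinate vector fields.\<close>

definition ext_deriv_rep ::
    "('p, 'e::fin_dim_inner) chart set \<Rightarrow> ('p, 'e) form2 \<Rightarrow> ('p, 'e) chart \<Rightarrow>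
     'e \<Rightarrow> 'e \<Rightarrow> 'e \<Rightarrow> 'e \<Rightarrow> real" where
  "ext_deriv_rep A \<omega> c y a b e =
     frechet_derivative (\<lambda>z. local_rep A \<omega> c z b e) (at y) a
   - frechet_derivative (\<lambda>z. local_rep A \<omega> c z a e) (at y) b
   + frechet_derivative (\<lambda>z. local_rep A \<omega> c z a b) (at y) e"

definition closed_form :: "('p, 'e::fin_dim_inner) chart set \<Rightarrow> ('p, 'e) form2 \<Rightarrow> bool" where
  "closed_form A \<omega> \<longleftrightarrow> (\<forall>c\<in>A. \<forall>y\<in>cimg c. \<forall>a b e. ext_deriv_rep A \<omega> c y a b e = 0)"

definition nondegenerate :: "('p, 'e::fin_dim_inner) chart set \<Rightarrow> ('p, 'e) form2 \<Rightarrow> bool" where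
  "nondegenerate A \<omega> \<longleftrightarrow> (\<forall>p. \<forall>u\<in>tangent_space A p.
     (\<forall>v\<in>tangent_space A p. \<omega> u v = 0) \<longrightarrow> u = (p, \<lambda>_. 0))"

definition symplectic_form :: "('p, 'e::fin_dim_inner) chart set \<Rightarrow> ('p, 'e) form2 \<Rightarrow> bool" where
  "symplectic_form A \<omega> \<longleftrightarrow> two_form A \<omega> \<and> closed_form A \<omega> \<and> nondegenerate A \<omega>"

definition interior_product ::
    "('p \<Rightarrow> ('p, 'e) tvec) \<Rightarrow> ('p, 'e) form2 \<Rightarrow> ('p, 'e) tvec \<Rightarrow> real" where
  "interior_product X \<omega> u = \<omega> (X (fst u)) u"

definition pullback ::
    "('p, 'e::fin_dim_inner) chart set \<Rightarrow> ('q, 'f::fin_dim_inner) chart set \<Rightarrow>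
     ('p \<Rightarrow> 'q) \<Rightarrow> ('q, 'f) form2 \<Rightarrow> ('p, 'e) form2" where
  "pullback A B f \<omega> u v = \<omega> (tangent_map A B f u) (tangent_map A B f v)"

definition hamiltonian_vector_field ::
    "('p, 'e::fin_dim_inner) chart set \<Rightarrow> ('p, 'e) form2 \<Rightarrow> ('p \<Rightarrow> real) \<Rightarrow>
     ('p \<Rightarrow> ('p, 'e) tvec) \<Rightarrow> bool" where
  "hamiltonian_vector_field A \<omega> H Z \<longleftrightarrow> vector_field A Z \<and>
     (\<forall>u\<in>tangent_bundle A. interior_product Z \<omega> u = differential A H u)"


section \<open>Submanifolds\<close>

definition submanifold ::
    "('p::topological_space, 'e::fin_dim_inner) chart set \<Rightarrow> 'p set \<Rightarrow> bool" where
  "submanifold A N \<longleftrightarrow> (\<forall>p\<in>N. \<exists>c\<in>maximal_atlas A. p \<in> cdom c \<and>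
     (\<exists>W. subspace W \<and> cmap c ` (cdom c \<inter> N) = cimg c \<inter> W))"

text \<open>Tangent vectors to \<open>N\<close> at \<open>p\<close>: velocities at time 0 of smooth curves lying in \<open>N\<close>.\<close>

definition tangent_to ::
    "('p::topological_space, 'e::fin_dim_inner) chart set \<Rightarrow> 'p set \<Rightarrow> 'p \<Rightarrow> ('p, 'e) tvec set" where
  "tangent_to A N p = {u. \<exists>\<epsilon>>0. \<exists>\<gamma>::real \<Rightarrow> 'p.
     smooth_map_on std_atlas A {-\<epsilon><..<\<epsilon>} \<gamma> \<and> \<gamma> ` {-\<epsilon><..<\<epsilon>} \<subseteq> N \<and> \<gamma> 0 = p \<and>
     u = tangent_map std_atlas A \<gamma> (coord_tvec std_atlas (Chart UNIV id) 0 1)}"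

definition isotropic_submanifold ::
    "('p::topological_space, 'e::fin_dim_inner) chart set \<Rightarrow> ('p, 'e) form2 \<Rightarrow> 'p set \<Rightarrow> bool" where
  "isotropic_submanifold A \<omega> N \<longleftrightarrow> submanifold A N \<and>
     (\<forall>p\<in>N. \<forall>u\<in>tangent_to A N p. \<forall>v\<in>tangent_to A N p. \<omega> u v = 0)"


section \<open>Fibre bundles and slicing sections\<close>

text \<open>\<open>A\<close>, \<open>B\<close> and \<open>F\<close> are the atlases of the total space, the base and the typical fibre.\<close>

definition fibre_bundle ::
    "('p::topological_space, 'e::fin_dim_inner) chart set \<Rightarrow>
     ('m::topological_space, 'b::fin_dim_inner) chart set \<Rightarrow>
     ('f::topological_space, 'g::fin_dim_inner) chart set \<Rightarrow> ('p \<Rightarrow> 'm) \<Rightarrow> bool" where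
  "fibre_bundle A B F \<pi> \<longleftrightarrow> smooth_map A B \<pi> \<and>
     (\<forall>x. \<exists>U \<Phi>. open U \<and> x \<in> U \<and> bij_betw \<Phi> (\<pi> -` U) (U \<times> UNIV) \<and>
        (\<forall>p\<in>\<pi> -` U. fst (\<Phi> p) = \<pi> p) \<and>
        smooth_map_on A (prod_atlas B F) (\<pi> -` U) \<Phi> \<and>
        smooth_map_on (prod_atlas B F) A (U \<times> UNIV) (inv_into (\<pi> -` U) \<Phi>))"

definition smooth_section ::
    "('p::topological_space, 'e::fin_dim_inner) chart set \<Rightarrow>
     ('m::topological_space, 'b::fin_dim_inner) chart set \<Rightarrow> ('p \<Rightarrow> 'm) \<Rightarrow> ('m \<Rightarrow> 'p) \<Rightarrow> bool" where
  "smooth_section A B \<pi> \<alpha> \<longleftrightarrow> smooth_map B A \<alpha> \<and> \<pi> \<circ> \<alpha> = id"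

definition slicing_section ::
    "('p::topological_space, 'e::fin_dim_inner) chart set \<Rightarrow>
     ('m::topological_space, 'b::fin_dim_inner) chart set \<Rightarrow> ('p \<Rightarrow> 'm) \<Rightarrow>
     ('p \<Rightarrow> ('p, 'e) tvec) \<Rightarrow> ('m \<Rightarrow> 'p) \<Rightarrow> bool" where
  "slicing_section A B \<pi> Z \<alpha> \<longleftrightarrow> smooth_section A B \<pi> \<alpha> \<and>
     (\<exists>X. vector_field B X \<and> tangent_map B A \<alpha> \<circ> X = Z \<circ> \<alpha>)"

end

theory Submission imports Defs begin

text \<open>Along the section, \<open>D = Z - T\<alpha> X\<close> is vertical, because \<open>T\<pi> D = X - X = 0\<close>, and the
  left-hand side of the equation, evaluated at \<open>u\<close>, equals \<open>- \<omega>(D, T\<alpha> u)\<close>. Every vector tangent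
  to \<open>P\<close> at \<open>\<alpha>(m)\<close> is the sum of one in the image of \<open>T\<alpha>\<close> and a vertical one, and \<open>\<omega>\<close> vanishes on
  pairs of vertical vectors since the fibres are isotropic. Hence the equation says that
  \<open>\<omega>(D, -) = 0\<close>, that is \<open>D = 0\<close>.\<close>


section \<open>Smooth functions on open sets\<close>

text \<open>The splitting rests on T\<pi> \<circ> T\<alpha> being the identity: T\<alpha> \<circ>
  T\<pi> is then a projection, and its kernel is the kernel of T\<pi>. Two gaps shape the proof. A
  vertical vector is recognised by T\<pi>, whereas isotropy speaks of velocities of smooth curves
  lying in a fibre; such a curve has to be built from a local trivialisation. Moreover, a slicing
  section requires X to be a smooth vector field. In coordinates X is the derivative of \<pi> taken
  at a moving point in a moving direction, while \<open>Ck_on\<close> only controls derivatives in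
  fixed directions; expanding the direction in finitely many coordinates reduces the one to the
  other.\<close>

lemma finite_coordinates:
  obtains B :: "'a::fin_dim_inner set"
  where "finite B" "\<And>w. w = (\<Sum>b\<in>B. ((w \<bullet> b) / (b \<bullet> b)) *\<^sub>R b)"
proof -
  obtain B0 :: "'a set" where B0: "finite B0" "\<And>x. \<exists>r. x = (\<Sum>b\<in>B0. r b *\<^sub>R b)"
    using finite_spanning by blast
  have span0: "span B0 = UNIV"
    using B0(2) by (auto simp: span_finite[OF B0(1)])
  \<comment> \<open>Orthogonality makes the coefficients inner products, hence bounded linear in the
    vector. A zero vector in \<open>B\<close> does no harm, since division by 0 yields 0.\<close>
  obtain B where B: "finite B" "span B = span B0" "pairwise orthogonal B"
    using basis_orthogonal[OF B0(1)] by auto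
  have "w = (\<Sum>b\<in>B. ((w \<bullet> b) / (b \<bullet> b)) *\<^sub>R b)" for w
  proof -
    have "w \<in> span B" using B(2) span0 by simp
    then show ?thesis
    proof (induction rule: span_induct_alt)
      case base then show ?case by simp
    next
      case (step c x y)
      have "(\<Sum>b\<in>B. ((x \<bullet> b) / (b \<bullet> b)) *\<^sub>R b) = (\<Sum>b\<in>B. if b = x then x else 0)"
        using B(3) step(1) by (intro sum.cong) (auto simp: pairwise_def orthogonal_def)
      also have "\<dots> = x" using B(1) step(1) by simp
      finally have x: "(\<Sum>b\<in>B. ((x \<bullet> b) / (b \<bullet> b)) *\<^sub>R b) = x" .
      have "(\<Sum>b\<in>B. (((c *\<^sub>R x + y) \<bullet> b) / (b \<bullet> b)) *\<^sub>R b) =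
          c *\<^sub>R (\<Sum>b\<in>B. ((x \<bullet> b) / (b \<bullet> b)) *\<^sub>R b) + (\<Sum>b\<in>B. ((y \<bullet> b) / (b \<bullet> b)) *\<^sub>R b)"
        by (simp add: inner_add_left add_divide_distrib scaleR_add_left sum.distrib scaleR_sum_right)
      then show ?case using x step(2) by simp
    qed
  qed
  with B(1) that show ?thesis by blast
qed

text \<open>No differentiability is assumed: \<open>frechet_derivative\<close> chooses among the
  derivatives at the point, and both functions have the same ones.\<close>

lemma frechet_derivative_cong_open:
  assumes "open S" "x \<in> S" "\<And>y. y \<in> S \<Longrightarrow> f y = g y"
  shows "frechet_derivative f (at x) = frechet_derivative g (at x)"
proof -
  have "(f has_derivative D) (at x) = (g has_derivative D) (at x)" for D
    using assms has_derivative_transform_within_open by metis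
  then show ?thesis by (simp add: frechet_derivative_def)
qed

lemma differentiable_cong_open:
  assumes "open S" "x \<in> S" "\<And>y. y \<in> S \<Longrightarrow> f y = g y" "f differentiable (at x)"
  shows "g differentiable (at x)"
  using assms has_derivative_transform_within_open unfolding differentiable_def by metis

lemma frechet_derivative_eqI:
  "(f has_derivative D) (at x) \<Longrightarrow> frechet_derivative f (at x) = D"
  using frechet_derivative_at by metis

section \<open>Closure properties of the class C^k\<close>

lemma Ck_on_subset: "Ck_on k T f \<Longrightarrow> S \<subseteq> T \<Longrightarrow> Ck_on k S f"
  by (induction k arbitrary: f) (auto intro: continuous_on_subset)

lemma Ck_on_Suc_imp: "Ck_on (Suc k) S f \<Longrightarrow> Ck_on k S f"
proof (induction k arbitrary: f)
  case 0 then show ?case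
    by (auto intro!: continuous_at_imp_continuous_on differentiable_imp_continuous_within)
next
  case (Suc k) then show ?case by (metis Ck_on.simps(2))
qed

lemma Ck_on_cong:
  assumes "open S" "\<And>x. x \<in> S \<Longrightarrow> f x = g x" "Ck_on k S f"
  shows "Ck_on k S g"
  using assms(2,3)
proof (induction k arbitrary: f g)
  case 0 then show ?case by (simp cong: continuous_on_cong)
next
  case (Suc k)
  have "Ck_on k S (\<lambda>x. frechet_derivative g (at x) v)" for v
  proof (rule Suc.IH)
    show "Ck_on k S (\<lambda>x. frechet_derivative f (at x) v)" using Suc.prems(2) by simp
  qed (metis frechet_derivative_cong_open[OF assms(1)] Suc.prems(1))
  moreover have "g differentiable (at x)" if "x \<in> S" for x
    using Suc.prems that by (intro differentiable_cong_open[OF assms(1) that, of f g]) simp_all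
  ultimately show ?case by simp
qed

text \<open>Serves for a vector field that is read through a chart of another manifold, available
  only near each point.\<close>

lemma Ck_on_local:
  assumes "\<And>x. x \<in> S \<Longrightarrow> \<exists>T. open T \<and> x \<in> T \<and> Ck_on k T f"
  shows "Ck_on k S f"
  using assms
proof (induction k arbitrary: f)
  case 0
  then show ?case
    by (metis Ck_on.simps(1) continuous_at_imp_continuous_on continuous_on_eq_continuous_at)
next
  case (Suc k)
  have "Ck_on k S (\<lambda>x. frechet_derivative f (at x) v)" for v
    using Suc.prems by (intro Suc.IH) (metis Ck_on.simps(2))
  moreover have "f differentiable (at x)" if "x \<in> S" for x
    using Suc.prems[OF that] by auto
  ultimately show ?case by simp
qed

lemma Ck_on_const: "Ck_on k S (\<lambda>x. c)"
  by (induction k arbitrary: c) (simp_all add: frechet_derivative_eqI[OF has_derivative_const])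

lemma Ck_on_bounded_linear_comp:
  assumes "bounded_linear L" "open S" "Ck_on k S f"
  shows "Ck_on k S (\<lambda>x. L (f x))"
  using assms(3)
proof (induction k arbitrary: f)
  case 0 then show ?case by (auto intro: bounded_linear.continuous_on[OF assms(1)])
next
  case (Suc k)
  have D: "((\<lambda>x. L (f x)) has_derivative (\<lambda>v. L (frechet_derivative f (at x) v))) (at x)" if "x \<in> S" for x
    using Suc.prems that
    by (intro bounded_linear.has_derivative[OF assms(1)]) (simp flip: frechet_derivative_works)
  have "Ck_on k S (\<lambda>x. frechet_derivative (\<lambda>x. L (f x)) (at x) v)" for v
  proof (rule Ck_on_cong[OF assms(2)])
    show "Ck_on k S (\<lambda>x. L (frechet_derivative f (at x) v))"
      using Suc.prems by (intro Suc.IH) simp_all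
  qed (simp add: frechet_derivative_eqI[OF D])
  then show ?case using D by (auto simp: differentiable_def)
qed

lemma Ck_on_add:
  assumes "open S" "Ck_on k S f" "Ck_on k S g"
  shows "Ck_on k S (\<lambda>x. f x + g x)"
  using assms(2,3)
proof (induction k arbitrary: f g)
  case 0 then show ?case by (auto intro: continuous_on_add)
next
  case (Suc k)
  have D: "((\<lambda>x. f x + g x) has_derivative
      (\<lambda>v. frechet_derivative f (at x) v + frechet_derivative g (at x) v)) (at x)" if "x \<in> S" for x
    using Suc.prems that by (intro has_derivative_add) (simp_all flip: frechet_derivative_works)
  have "Ck_on k S (\<lambda>x. frechet_derivative (\<lambda>x. f x + g x) (at x) v)" for v
  proof (rule Ck_on_cong[OF assms(1)])
    show "Ck_on k S (\<lambda>x. frechet_derivative f (at x) v + frechet_derivative g (at x) v)"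
      using Suc.prems by (intro Suc.IH) simp_all
  qed (simp add: frechet_derivative_eqI[OF D])
  then show ?case using D by (auto simp: differentiable_def)
qed

lemma Ck_on_sum:
  assumes "open S" "finite I" "\<And>i. i \<in> I \<Longrightarrow> Ck_on k S (f i)"
  shows "Ck_on k S (\<lambda>x. \<Sum>i\<in>I. f i x)"
  using assms(2,3) by (induction rule: finite_induct) (simp_all add: Ck_on_const Ck_on_add assms(1))

lemma Ck_on_scaleR:
  fixes f :: "'a::real_normed_vector \<Rightarrow> real" and g :: "'a \<Rightarrow> 'b::real_normed_vector"
  assumes "open S" "Ck_on k S f" "Ck_on k S g"
  shows "Ck_on k S (\<lambda>x. f x *\<^sub>R g x)"
  using assms(2,3)
proof (induction k arbitrary: f g)
  case 0 then show ?case by (auto intro: continuous_on_scaleR)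
next
  case (Suc k)
  have D: "((\<lambda>x. f x *\<^sub>R g x) has_derivative
      (\<lambda>v. f x *\<^sub>R frechet_derivative g (at x) v + frechet_derivative f (at x) v *\<^sub>R g x)) (at x)"
    if "x \<in> S" for x
    using Suc.prems that by (intro has_derivative_scaleR) (simp_all flip: frechet_derivative_works)
  \<comment> \<open>The product rule retains undifferentiated factors, which are C^k by
    \<open>Ck_on_Suc_imp\<close>.\<close>
  have "Ck_on k S (\<lambda>x. f x *\<^sub>R frechet_derivative g (at x) v + frechet_derivative f (at x) v *\<^sub>R g x)" for v
    using Suc.prems Ck_on_Suc_imp[OF Suc.prems(1)] Ck_on_Suc_imp[OF Suc.prems(2)]
    by (intro Ck_on_add[OF assms(1)] Suc.IH) simp_all
  then have "Ck_on k S (\<lambda>x. frechet_derivative (\<lambda>x. f x *\<^sub>R g x) (at x) v)" for v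
    by (rule Ck_on_cong[OF assms(1), rotated]) (simp add: frechet_derivative_eqI[OF D])
  then show ?case using D by (auto simp: differentiable_def)
qed

text \<open>Expanding \<open>z x\<close> in finitely many coordinates turns \<open>G x (z x)\<close>
  into a sum of C^k scalars times \<open>G x b\<close> with \<open>b\<close> fixed. This admits
  directions that move with the point.\<close>

lemma Ck_on_linear_apply:
  fixes z :: "'a::real_normed_vector \<Rightarrow> 'b::fin_dim_inner"
    and G :: "'a \<Rightarrow> 'b \<Rightarrow> 'c::real_normed_vector"
  assumes "open S" "\<And>x. x \<in> S \<Longrightarrow> linear (G x)" "\<And>b. Ck_on k S (\<lambda>x. G x b)" "Ck_on k S z"
  shows "Ck_on k S (\<lambda>x. G x (z x))"
proof -
  obtain B :: "'b set" where B: "finite B" "\<And>w. w = (\<Sum>b\<in>B. ((w \<bullet> b) / (b \<bullet> b)) *\<^sub>R b)"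
    using finite_coordinates by blast
  have "bounded_linear (\<lambda>w. (w \<bullet> b) / (b \<bullet> b))" for b :: 'b
    by (intro bounded_linear_divide[THEN bounded_linear_compose] bounded_linear_inner_left)
  then have "Ck_on k S (\<lambda>x. (z x \<bullet> b) / (b \<bullet> b))" for b
    using assms(1,4) by (rule Ck_on_bounded_linear_comp)
  then have C: "Ck_on k S (\<lambda>x. \<Sum>b\<in>B. ((z x \<bullet> b) / (b \<bullet> b)) *\<^sub>R G x b)"
    using assms B(1) by (intro Ck_on_sum Ck_on_scaleR) auto
  show ?thesis
  proof (rule Ck_on_cong[OF assms(1) _ C])
    fix x assume "x \<in> S"
    then have "(\<Sum>b\<in>B. ((z x \<bullet> b) / (b \<bullet> b)) *\<^sub>R G x b) = G x (\<Sum>b\<in>B. ((z x \<bullet> b) / (b \<bullet> b)) *\<^sub>R b)"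
      by (simp add: linear_sum linear_scale assms(2))
    then show "(\<Sum>b\<in>B. ((z x \<bullet> b) / (b \<bullet> b)) *\<^sub>R G x b) = G x (z x)"
      using B(2)[of "z x"] by simp
  qed
qed

text \<open>By the chain rule the derivative of \<open>g\<close> at \<open>f x\<close> is applied to
  a direction depending on \<open>x\<close>, a case of \<open>Ck_on_linear_apply\<close>. The
  induction hypothesis is then applied to the derivatives of \<open>g\<close> in fixed directions,
  with the same \<open>f\<close>.\<close>

lemma Ck_on_compose:
  fixes f :: "'a::real_normed_vector \<Rightarrow> 'b::fin_dim_inner"
  assumes "open S" "f ` S \<subseteq> T" "Ck_on k S f" "Ck_on k T g"
  shows "Ck_on k S (\<lambda>x. g (f x))"
  using assms(3,4)
proof (induction k arbitrary: g)
  case 0 then show ?case using assms(2) continuous_on_compose2 by auto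
next
  case (Suc k)
  have df: "(f has_derivative frechet_derivative f (at x)) (at x)" if "x \<in> S" for x
    using Suc.prems(1) that by (simp flip: frechet_derivative_works)
  have dg: "(g has_derivative frechet_derivative g (at (f x))) (at (f x))" if "x \<in> S" for x
    using Suc.prems(2) that assms(2) by (auto simp flip: frechet_derivative_works)
  have D: "((\<lambda>x. g (f x)) has_derivative
      (\<lambda>v. frechet_derivative g (at (f x)) (frechet_derivative f (at x) v))) (at x)" if "x \<in> S" for x
    using diff_chain_at[OF df dg] that by (simp add: o_def)
  have "Ck_on k S (\<lambda>x. frechet_derivative g (at (f x)) (frechet_derivative f (at x) v))" for v
  proof (rule Ck_on_linear_apply[OF assms(1), where z = "\<lambda>x. frechet_derivative f (at x) v"])
    fix b
    have "Ck_on k T (\<lambda>y. frechet_derivative g (at y) b)" using Suc.prems(2) by simp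
    then show "Ck_on k S (\<lambda>x. frechet_derivative g (at (f x)) b)"
      by (rule Suc.IH[OF Ck_on_Suc_imp[OF Suc.prems(1)]])
  next
    show "Ck_on k S (\<lambda>x. frechet_derivative f (at x) v)" using Suc.prems(1) by simp
  qed (use dg has_derivative_linear in blast)
  then have "Ck_on k S (\<lambda>x. frechet_derivative (\<lambda>x. g (f x)) (at x) v)" for v
    by (rule Ck_on_cong[OF assms(1), rotated]) (simp add: frechet_derivative_eqI[OF D])
  then show ?case using D by (auto simp: differentiable_def)
qed

section \<open>Transfer from C^k to smooth functions\<close>

lemma smooth_on_imp_differentiable: "smooth_on S f \<Longrightarrow> x \<in> S \<Longrightarrow> f differentiable (at x)"
  unfolding smooth_on_def using Ck_on.simps(2)[of 0] by blast

lemma smooth_on_frechet_derivative: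
  "smooth_on S f \<Longrightarrow> smooth_on S (\<lambda>x. frechet_derivative f (at x) v)"
  unfolding smooth_on_def using Ck_on.simps(2) by blast

lemma smooth_on_compose:
  fixes f :: "'a::real_normed_vector \<Rightarrow> 'b::fin_dim_inner"
  assumes "open S" "f ` S \<subseteq> T" "smooth_on S f" "smooth_on T g"
  shows "smooth_on S (\<lambda>x. g (f x))"
  using assms Ck_on_compose unfolding smooth_on_def by blast

lemma smooth_on_cong:
  assumes "open S" "\<And>x. x \<in> S \<Longrightarrow> f x = g x" "smooth_on S f"
  shows "smooth_on S g"
  using assms Ck_on_cong unfolding smooth_on_def by blast

lemma smooth_on_local:
  assumes "\<And>x. x \<in> S \<Longrightarrow> \<exists>T. open T \<and> x \<in> T \<and> smooth_on T f"
  shows "smooth_on S f"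
  unfolding smooth_on_def using assms by (meson Ck_on_local smooth_on_def)

lemma smooth_on_linear_apply:
  fixes z :: "'a::real_normed_vector \<Rightarrow> 'b::fin_dim_inner"
    and G :: "'a \<Rightarrow> 'b \<Rightarrow> 'c::real_normed_vector"
  assumes "open S" "\<And>x. x \<in> S \<Longrightarrow> linear (G x)" "\<And>b. smooth_on S (\<lambda>x. G x b)" "smooth_on S z"
  shows "smooth_on S (\<lambda>x. G x (z x))"
  using assms Ck_on_linear_apply unfolding smooth_on_def by blast

lemma smooth_on_id: "smooth_on S (id :: 'a::real_normed_vector \<Rightarrow> 'a)"
proof -
  have "Ck_on k S (\<lambda>x. x)" for k
  proof (cases k)
    case (Suc j) then show ?thesis
      by (simp add: frechet_derivative_eqI[OF has_derivative_ident] Ck_on_const)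
  qed simp
  then show ?thesis by (simp add: smooth_on_def id_def)
qed

text \<open>The straight line that a trivialisation turns into a curve in a fibre.\<close>

lemma smooth_on_affine: "smooth_on S (\<lambda>t::real. a + t *\<^sub>R w)"
proof -
  have "Ck_on k UNIV (\<lambda>t::real. t)" for k
    using smooth_on_id[of "UNIV :: real set"] by (simp add: smooth_on_def id_def)
  then have "Ck_on k UNIV (\<lambda>t::real. a + t *\<^sub>R w)" for k
    by (intro Ck_on_add Ck_on_scaleR Ck_on_const) simp_all
  then show ?thesis
    unfolding smooth_on_def using Ck_on_subset by blast
qed


section \<open>Charts and tangent maps\<close>

lemma cinv_cmap: "is_chart c \<Longrightarrow> p \<in> cdom c \<Longrightarrow> cinv c (cmap c p) = p"
  by (simp add: is_chart_def homeomorphism_def)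

lemma cmap_cinv: "is_chart c \<Longrightarrow> y \<in> cimg c \<Longrightarrow> cmap c (cinv c y) = y"
  by (simp add: is_chart_def homeomorphism_def)

lemma cinv_in_cdom: "is_chart c \<Longrightarrow> y \<in> cimg c \<Longrightarrow> cinv c y \<in> cdom c"
  unfolding is_chart_def homeomorphism_def by blast

lemma cmap_in_cimg: "p \<in> cdom c \<Longrightarrow> cmap c p \<in> cimg c"
  by (simp add: cimg_def)

lemma open_cmap_image:
  assumes "is_chart c" "open U"
  shows "open (cmap c ` (cdom c \<inter> U))"
proof -
  have "openin (top_of_set (cimg c)) (cmap c ` (cdom c \<inter> U))"
    using assms unfolding is_chart_def
    by (intro homeomorphism_imp_open_map[of "cdom c"]) (auto simp: openin_open)
  then show ?thesis
    using assms(1) unfolding is_chart_def by (auto intro: openin_open_trans)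
qed

text \<open>The tangent map of \<open>f\<close> at \<open>p\<close> in coordinates. For
  \<open>f = id\<close> it is the derivative of a transition map, so changes of chart and tangent
  maps obey one chain rule.\<close>

definition chart_deriv ::
    "('p, 'e::real_normed_vector) chart \<Rightarrow> ('q, 'f::real_normed_vector) chart \<Rightarrow>
     ('p \<Rightarrow> 'q) \<Rightarrow> 'p \<Rightarrow> 'e \<Rightarrow> 'f" where
  "chart_deriv c d f p = frechet_derivative (cmap d \<circ> f \<circ> cinv c) (at (cmap c p))"

lemma open_smooth_map_domain:
  assumes "open S" "continuous_on S f" "is_chart d"
  shows "open (S \<inter> f -` cdom d)"
  using assms continuous_open_preimage unfolding is_chart_def by blast

lemma smooth_map_on_differentiable:
  assumes "smooth_map_on A B S f" "p \<in> S" "c \<in> A" "p \<in> cdom c" "d \<in> B" "f p \<in> cdom d"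
  shows "(cmap d \<circ> f \<circ> cinv c) differentiable (at (cmap c p))"
proof -
  have "smooth_on (cmap c ` (cdom c \<inter> S \<inter> f -` cdom d)) (cmap d \<circ> f \<circ> cinv c)"
    using assms by (simp add: smooth_map_on_def)
  then show ?thesis using assms by (intro smooth_on_imp_differentiable) auto
qed

lemma linear_chart_deriv:
  assumes "smooth_map_on A B S f" "p \<in> S" "c \<in> A" "p \<in> cdom c" "d \<in> B" "f p \<in> cdom d"
  shows "linear (chart_deriv c d f p)"
  unfolding chart_deriv_def
  by (rule linear_frechet_derivative[OF smooth_map_on_differentiable[OF assms]])

text \<open>The coordinate form of \<open>g \<circ> f\<close> factors through \<open>d\<close> only
  where \<open>f\<close> stays in \<open>cdom d\<close>, that is on the open set \<open>?O\<close>
  around the point; this is enough for derivatives. Taking \<open>id\<close> for \<open>f\<close> or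
  \<open>g\<close> gives the rules for changing charts.\<close>

lemma chart_deriv_comp:
  assumes f: "smooth_map_on A B S f" "open S" "p \<in> S" "c \<in> A" "is_chart c" "p \<in> cdom c"
      "d \<in> B" "is_chart d" "f p \<in> cdom d"
    and g: "smooth_map_on B C T g" "f p \<in> T" "e \<in> C" "g (f p) \<in> cdom e"
  shows "chart_deriv c e (g \<circ> f) p = chart_deriv d e g (f p) \<circ> chart_deriv c d f p"
proof -
  let ?O = "cmap c ` (cdom c \<inter> (S \<inter> f -` cdom d))"
  let ?F = "cmap d \<circ> f \<circ> cinv c" and ?G = "cmap e \<circ> g \<circ> cinv d"
  have F: "?F (cmap c p) = cmap d (f p)" by (simp add: cinv_cmap f)
  have "open ?O"
    using f by (intro open_cmap_image open_smooth_map_domain) (auto simp: smooth_map_on_def)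
  moreover have "cmap c p \<in> ?O" using f by auto
  ultimately have "frechet_derivative (cmap e \<circ> (g \<circ> f) \<circ> cinv c) (at (cmap c p))
      = frechet_derivative (?G \<circ> ?F) (at (cmap c p))"
    by (rule frechet_derivative_cong_open) (use f in \<open>auto simp: cinv_cmap\<close>)
  also have "\<dots> = frechet_derivative ?G (at (?F (cmap c p))) \<circ> frechet_derivative ?F (at (cmap c p))"
    by (rule frechet_derivative_compose[OF smooth_map_on_differentiable[OF f(1,3,4,6,7,9)]])
      (simp only: F smooth_map_on_differentiable[OF g(1,2) f(7,9) g(3,4)])
  finally show ?thesis unfolding chart_deriv_def F .
qed

lemma chart_deriv_id:
  assumes "is_chart c" "p \<in> cdom c"
  shows "chart_deriv c c id p = id"
proof -
  have "frechet_derivative (cmap c \<circ> id \<circ> cinv c) (at (cmap c p)) = frechet_derivative id (at (cmap c p))"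
    using assms
    by (intro frechet_derivative_cong_open[of "cimg c"]) (auto simp: is_chart_def cmap_in_cimg cmap_cinv)
  then show ?thesis
    by (simp add: chart_deriv_def frechet_derivative_eqI[OF has_derivative_id] id_def)
qed

text \<open>For a trivialisation and its inverse, which compose to the identity only on an open
  set.\<close>

lemma chart_deriv_cong_open:
  assumes "is_chart c" "p \<in> cdom c" "open S" "p \<in> S" "\<And>q. q \<in> S \<Longrightarrow> f q = g q"
  shows "chart_deriv c d f p = chart_deriv c d g p"
  unfolding chart_deriv_def
  by (rule frechet_derivative_cong_open[OF open_cmap_image[OF assms(1,3)]])
    (use assms in \<open>auto simp: cinv_cmap\<close>)

lemma manifold_chart: "smooth_manifold A \<Longrightarrow> c \<in> A \<Longrightarrow> is_chart c"
  by (simp add: smooth_manifold_def)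

lemma chart_at:
  assumes "smooth_manifold A"
  shows "chart_at A p \<in> A" "p \<in> cdom (chart_at A p)"
proof -
  have "\<exists>c. c \<in> A \<and> p \<in> cdom c" using assms unfolding smooth_manifold_def by blast
  then have "chart_at A p \<in> A \<and> p \<in> cdom (chart_at A p)"
    unfolding chart_at_def by (rule someI_ex)
  then show "chart_at A p \<in> A" "p \<in> cdom (chart_at A p)" by auto
qed

text \<open>In charts the identity is a transition map, so its smoothness is the compatibility of
  the atlas.\<close>

lemma smooth_map_id: "smooth_manifold A \<Longrightarrow> smooth_map A A id"
  by (auto simp: smooth_map_on_def smooth_manifold_def compatible_def transition_def)

lemma chart_deriv_transition:
  "frechet_derivative (transition c d) (at (cmap c p)) = chart_deriv c d id p"
  by (simp add: chart_deriv_def transition_def)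

lemma cinv_std: "cinv (Chart UNIV id) = id"
  by (simp add: cinv_def flip: id_def)

lemma is_chart_std: "is_chart (Chart UNIV id :: ('e::fin_dim_inner, 'e) chart)"
  by (simp add: is_chart_def cimg_def cinv_std homeomorphism_def)

lemma smooth_manifold_std:
  "smooth_manifold (std_atlas :: ('e::{fin_dim_inner, second_countable_topology}, 'e) chart set)"
  by (simp add: smooth_manifold_def std_atlas_def is_chart_std compatible_def transition_def
      smooth_on_id cinv_std)

section \<open>Tangent vectors and tangent maps\<close>

lemma tangent_space_iff:
  "u \<in> tangent_space A p \<longleftrightarrow> fst u = p \<and>
    (\<forall>c\<in>A. \<forall>d\<in>A. p \<in> cdom c \<longrightarrow> p \<in> cdom d \<longrightarrow> snd u d = chart_deriv c d id p (snd u c)) \<and>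
    (\<forall>c. \<not> (c \<in> A \<and> p \<in> cdom c) \<longrightarrow> snd u c = 0)"
  unfolding tangent_space_def chart_deriv_transition by (cases u) auto

lemma tangent_space_fst: "u \<in> tangent_space A p \<Longrightarrow> fst u = p"
  by (auto simp: tangent_space_def)

lemma tangent_space_transition:
  "u \<in> tangent_space A p \<Longrightarrow> c \<in> A \<Longrightarrow> p \<in> cdom c \<Longrightarrow> d \<in> A \<Longrightarrow> p \<in> cdom d \<Longrightarrow>
    snd u d = chart_deriv c d id p (snd u c)"
  unfolding tangent_space_iff by blast

lemma tangent_space_outside:
  "u \<in> tangent_space A p \<Longrightarrow> \<not> (c \<in> A \<and> p \<in> cdom c) \<Longrightarrow> snd u c = 0"
  unfolding tangent_space_iff by blast

text \<open>One coordinate vector determines those in all charts around \<open>p\<close> by the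
  transition rule; the remaining values are 0 by convention.\<close>

lemma tangent_space_eqI:
  assumes "u \<in> tangent_space A p" "v \<in> tangent_space A p" "c \<in> A" "p \<in> cdom c"
    and "snd u c = snd v c"
  shows "u = v"
proof (rule prod_eqI)
  show "snd u = snd v"
  proof
    fix d show "snd u d = snd v d"
      using tangent_space_transition[OF assms(1,3,4)] tangent_space_transition[OF assms(2-4)]
        tangent_space_outside[OF assms(1)] tangent_space_outside[OF assms(2)] assms(5) by metis
  qed
qed (use assms(1,2) in \<open>simp add: tangent_space_fst\<close>)

lemma fst_tangent_map [simp]: "fst (tangent_map A B f u) = f (fst u)"
  by (simp add: tangent_map_def Let_def)

text \<open>\<open>tangent_map\<close> reads \<open>u\<close> only in the chosen chart
  \<open>chart_at A p\<close>. The chain rule for \<open>f \<circ> id\<close>, with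
  \<open>id\<close> as change of chart in the source, passes to an arbitrary
  \<open>c\<close>.\<close>

lemma snd_tangent_map:
  assumes A: "smooth_manifold A" and f: "smooth_map_on A B S f" "p \<in> S"
    and u: "u \<in> tangent_space A p"
    and c: "c \<in> A" "p \<in> cdom c" and d: "d \<in> B" "f p \<in> cdom d"
  shows "snd (tangent_map A B f u) d = chart_deriv c d f p (snd u c)"
proof -
  let ?k = "chart_at A p"
  note k = chart_at[OF A, of p]
  have p: "fst u = p" using u by (rule tangent_space_fst)
  have "chart_deriv ?k d (f \<circ> id) p = chart_deriv c d f (id p) \<circ> chart_deriv ?k c id p"
    using smooth_map_id[OF A] manifold_chart[OF A] k c f d
    by (intro chart_deriv_comp[of A A UNIV id p ?k c B S f d]) simp_all
  moreover have "snd u c = chart_deriv ?k c id p (snd u ?k)"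
    by (rule tangent_space_transition[OF u k c])
  ultimately have "chart_deriv ?k d f p (snd u ?k) = chart_deriv c d f p (snd u c)" by simp
  then show ?thesis using d p by (simp add: tangent_map_def Let_def chart_deriv_def)
qed

text \<open>The chain rule for \<open>id \<circ> f\<close> is the transition rule in the target. The
  open set \<open>S\<close> accommodates curves defined on an interval.\<close>

lemma tangent_map_in_tangent_space:
  assumes A: "smooth_manifold A" and B: "smooth_manifold B"
    and f: "smooth_map_on A B S f" "open S" "p \<in> S"
    and u: "u \<in> tangent_space A p"
  shows "tangent_map A B f u \<in> tangent_space B (f p)"
proof -
  let ?k = "chart_at A p"
  note k = chart_at[OF A, of p]
  have p: "fst u = p" using u by (rule tangent_space_fst)
  have "snd (tangent_map A B f u) d' = chart_deriv d d' id (f p) (snd (tangent_map A B f u) d)"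
    if "d \<in> B" "d' \<in> B" "f p \<in> cdom d" "f p \<in> cdom d'" for d d'
  proof -
    have "chart_deriv ?k d' (id \<circ> f) p = chart_deriv d d' id (f p) \<circ> chart_deriv ?k d f p"
      using smooth_map_id[OF B] manifold_chart[OF A] manifold_chart[OF B] k f that
      by (intro chart_deriv_comp[of A B S f p ?k d B UNIV id d']) simp_all
    then show ?thesis
      using snd_tangent_map[OF A f(1,3) u k that(1,3)] snd_tangent_map[OF A f(1,3) u k that(2,4)]
      by simp
  qed
  moreover have "snd (tangent_map A B f u) d = 0" if "\<not> (d \<in> B \<and> f p \<in> cdom d)" for d
    using that unfolding tangent_map_def Let_def p snd_conv by (rule if_not_P)
  ultimately show ?thesis unfolding tangent_space_iff fst_tangent_map p by blast
qed

text \<open>\<open>u\<close> may be arbitrary: both sides read it only in \<open>?c\<close>, and the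
  intermediate vector is read only in \<open>?d\<close>.\<close>

lemma tangent_map_comp:
  assumes A: "smooth_manifold A" and B: "smooth_manifold B"
    and f: "smooth_map A B f" and g: "smooth_map B C g"
  shows "tangent_map A C (g \<circ> f) u = tangent_map B C g (tangent_map A B f u)"
proof -
  let ?p = "fst u"
  let ?c = "chart_at A ?p" and ?d = "chart_at B (f ?p)"
  note c = chart_at[OF A, of ?p] and d = chart_at[OF B, of "f ?p"]
  have "chart_deriv ?c e (g \<circ> f) ?p = chart_deriv ?d e g (f ?p) \<circ> chart_deriv ?c ?d f ?p"
    if "e \<in> C" "g (f ?p) \<in> cdom e" for e
    using f g c d that manifold_chart[OF A] manifold_chart[OF B]
    by (intro chart_deriv_comp[of A B UNIV f ?p ?c ?d C UNIV g e]) simp_all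
  then show ?thesis
    by (auto simp: tangent_map_def Let_def chart_deriv_def[symmetric] d)
qed

text \<open>\<open>tangent_map\<close> recomputes all coordinates from a single one, so
  \<open>u\<close> is recovered because its coordinates are related by the transition rule.\<close>

lemma tangent_map_id:
  assumes "smooth_manifold A" "u \<in> tangent_space A p"
  shows "tangent_map A A id u = u"
proof -
  note k = chart_at[OF assms(1), of p]
  have *: "tangent_map A A id u \<in> tangent_space A p"
    using tangent_map_in_tangent_space[OF assms(1,1) smooth_map_id[OF assms(1)] _ _ assms(2)] by simp
  have "snd (tangent_map A A id u) (chart_at A p) = snd u (chart_at A p)"
    using snd_tangent_map[OF assms(1) smooth_map_id[OF assms(1)] _ assms(2) k k(1)] k
      chart_deriv_id[OF manifold_chart[OF assms(1) k(1)] k(2)] by simp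
  then show ?thesis by (rule tangent_space_eqI[OF * assms(2) k])
qed

text \<open>Makes \<open>local_rep\<close>, which only sees vectors built by
  \<open>coord_tvec\<close>, available for all tangent vectors.\<close>

lemma coord_tvec_snd:
  assumes "u \<in> tangent_space A p" "c \<in> A" "p \<in> cdom c"
  shows "coord_tvec A c p (snd u c) = u"
proof -
  have "(if d \<in> A \<and> p \<in> cdom d then chart_deriv c d id p (snd u c) else 0) = snd u d" for d
    using tangent_space_transition[OF assms] tangent_space_outside[OF assms(1)] by metis
  then show ?thesis
    using tangent_space_fst[OF assms(1)]
    unfolding coord_tvec_def chart_deriv_transition by (intro prod_eqI) simp_all
qed

lemma coord_tvec_in_tangent_space:
  assumes A: "smooth_manifold A" and c: "c \<in> A" "p \<in> cdom c"
  shows "coord_tvec A c p a \<in> tangent_space A p"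
proof -
  have chain: "chart_deriv c e id p a = chart_deriv d e id p (chart_deriv c d id p a)"
    if "d \<in> A" "e \<in> A" "p \<in> cdom d" "p \<in> cdom e" for d e
    using chart_deriv_comp[of A A UNIV id p c d A UNIV id e]
      smooth_map_id[OF A] manifold_chart[OF A] c that by simp
  show ?thesis
    unfolding tangent_space_iff coord_tvec_def chart_deriv_transition by (auto intro: chain)
qed

lemma snd_coord_tvec:
  assumes "is_chart c" "c \<in> A" "p \<in> cdom c"
  shows "snd (coord_tvec A c p a) c = a"
  using assms by (simp add: coord_tvec_def chart_deriv_transition chart_deriv_id)

text \<open>Only meaningful for vectors with the same base point.\<close>

definition tvec_diff :: "('p, 'e::real_vector) tvec \<Rightarrow> ('p, 'e) tvec \<Rightarrow> ('p, 'e) tvec" where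
  "tvec_diff u v = (fst u, \<lambda>c. snd u c - snd v c)"

lemma snd_tvec_diff [simp]: "snd (tvec_diff u v) c = snd u c - snd v c"
  by (simp add: tvec_diff_def)

lemma tvec_diff_in_tangent_space:
  assumes A: "smooth_manifold A" and uv: "u \<in> tangent_space A p" "v \<in> tangent_space A p"
  shows "tvec_diff u v \<in> tangent_space A p"
proof -
  have "linear (chart_deriv c d id p)" if "c \<in> A" "d \<in> A" "p \<in> cdom c" "p \<in> cdom d" for c d
    using that by (intro linear_chart_deriv[OF smooth_map_id[OF A]]) simp_all
  then have "chart_deriv c d id p (snd u c - snd v c) = snd u d - snd v d"
    if "c \<in> A" "d \<in> A" "p \<in> cdom c" "p \<in> cdom d" for c d
    using that tangent_space_transition[OF uv(1), of c d] tangent_space_transition[OF uv(2), of c d]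
    by (simp add: linear_diff)
  then show ?thesis
    using tangent_space_fst[OF uv(1)] tangent_space_outside[OF uv(1)] tangent_space_outside[OF uv(2)]
    unfolding tangent_space_iff by (simp add: tvec_diff_def)
qed

lemma tangent_map_diff:
  assumes A: "smooth_manifold A" and f: "smooth_map A B f"
    and uv: "u \<in> tangent_space A p" "v \<in> tangent_space A p"
  shows "tangent_map A B f (tvec_diff u v) = tvec_diff (tangent_map A B f u) (tangent_map A B f v)"
proof -
  let ?c = "chart_at A p"
  note c = chart_at[OF A, of p]
  have "linear (chart_deriv ?c d f p)" if "d \<in> B" "f p \<in> cdom d" for d
    using that c by (intro linear_chart_deriv[OF f]) simp_all
  then show ?thesis
    using tangent_space_fst[OF uv(1)] tangent_space_fst[OF uv(2)]
    by (auto simp: tangent_map_def Let_def tvec_diff_def linear_diff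
        simp flip: chart_deriv_def)
qed

lemma tvec_diff_eq_zero_iff:
  assumes "u \<in> tangent_space A p" "v \<in> tangent_space A p"
  shows "tvec_diff u v = (p, \<lambda>_. 0) \<longleftrightarrow> u = v"
  using tangent_space_fst[OF assms(1)] tangent_space_fst[OF assms(2)]
  by (cases u; cases v) (auto simp: tvec_diff_def fun_eq_iff)

text \<open>\<open>two_form\<close> postulates bilinearity for \<open>local_rep\<close> only. In the
  chart \<open>?c\<close> a difference of tangent vectors becomes a difference of coordinate
  vectors.\<close>

lemma two_form_diff:
  assumes A: "smooth_manifold A" and w: "two_form A \<omega>"
    and uv: "u \<in> tangent_space A p" "v \<in> tangent_space A p" "w \<in> tangent_space A p"
  shows "\<omega> (tvec_diff u v) w = \<omega> u w - \<omega> v w"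
    and "\<omega> w (tvec_diff u v) = \<omega> w u - \<omega> w v"
proof -
  let ?c = "chart_at A p"
  let ?l = "local_rep A \<omega> ?c (cmap ?c p)"
  note c = chart_at[OF A, of p]
  have bil: "bilinear ?l" using w c cmap_in_cimg[OF c(2)] unfolding two_form_def by blast
  have l: "\<omega> a b = ?l (snd a ?c) (snd b ?c)" if "a \<in> tangent_space A p" "b \<in> tangent_space A p" for a b
    using that c manifold_chart[OF A c(1)] by (simp add: local_rep_def cinv_cmap coord_tvec_snd)
  note d = tvec_diff_in_tangent_space[OF A uv(1,2)]
  show "\<omega> (tvec_diff u v) w = \<omega> u w - \<omega> v w" "\<omega> w (tvec_diff u v) = \<omega> w u - \<omega> w v"
    using l d uv bilinear_lsub[OF bil] bilinear_rsub[OF bil] by simp_all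
qed

text \<open>A differential is a coordinate of a tangent map into the reals, so this is the chain
  rule for tangent maps.\<close>

lemma differential_comp:
  assumes A: "smooth_manifold A" and B: "smooth_manifold B"
    and f: "smooth_map A B f" and h: "smooth_function B h"
  shows "differential A (h \<circ> f) u = differential B h (tangent_map A B f u)"
  using tangent_map_comp[OF A B f h] by (simp add: differential_def)

section \<open>Product charts\<close>

abbreviation prod_chart :: "('p, 'e) chart \<Rightarrow> ('q, 'f) chart \<Rightarrow> ('p \<times> 'q, 'e \<times> 'f) chart" where
  "prod_chart c d \<equiv> Chart (cdom c \<times> cdom d) (map_prod (cmap c) (cmap d))"

lemma cimg_prod_chart: "cimg (prod_chart c d) = cimg c \<times> cimg d"
  unfolding cimg_def by auto

lemma cinv_prod_chart:
  assumes "is_chart c" "is_chart d" "a \<in> cimg c" "b \<in> cimg d"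
  shows "cinv (prod_chart c d) (a, b) = (cinv c a, cinv d b)"
proof -
  have "inj_on (cmap c) (cdom c)" "inj_on (cmap d) (cdom d)"
    using assms(1,2) by (metis cinv_cmap inj_onI)+
  then have "inj_on (map_prod (cmap c) (cmap d)) (cdom c \<times> cdom d)"
    by (rule map_prod_inj_on)
  moreover have "(a, b) = map_prod (cmap c) (cmap d) (cinv c a, cinv d b)"
    using assms by (simp add: cmap_cinv)
  moreover have "(cinv c a, cinv d b) \<in> cdom c \<times> cdom d"
    using assms by (simp add: cinv_in_cdom)
  ultimately show ?thesis
    by (simp only: cinv_def[of "prod_chart c d"] chart.sel inv_into_f_f)
qed

lemma is_chart_prod_chart:
  assumes "is_chart c" "is_chart d"
  shows "is_chart (prod_chart c d)"
proof -
  let ?k = "prod_chart c d"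
  have c: "open (cdom c)" "open (cimg c)" "continuous_on (cdom c) (cmap c)" "continuous_on (cimg c) (cinv c)"
    and d: "open (cdom d)" "open (cimg d)" "continuous_on (cdom d) (cmap d)" "continuous_on (cimg d) (cinv d)"
    using assms by (simp_all add: is_chart_def homeomorphism_def)
  have inv: "cinv ?k z = map_prod (cinv c) (cinv d) z" if "z \<in> cimg c \<times> cimg d" for z
    using that assms by (auto simp: cinv_prod_chart)
  have map_cont: "continuous_on (S \<times> T) (map_prod f g)"
    if "continuous_on S f" "continuous_on T g" for f g and S T
  proof -
    have "continuous_on (S \<times> T) (\<lambda>z. (f (fst z), g (snd z)))"
      by (intro continuous_on_Pair continuous_on_compose2[OF that(1)] continuous_on_compose2[OF that(2)]
          continuous_on_fst continuous_on_snd continuous_on_id) auto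
    then show ?thesis by (simp add: map_prod_def case_prod_unfold)
  qed
  have "homeomorphism (cdom ?k) (cimg ?k) (cmap ?k) (cinv ?k)"
  proof (rule homeomorphismI)
    show "continuous_on (cdom ?k) (cmap ?k)" using map_cont[OF c(3) d(3)] by simp
    show "continuous_on (cimg ?k) (cinv ?k)"
      using continuous_on_cong[THEN iffD2, OF refl inv map_cont[OF c(4) d(4)]]
      by (simp add: cimg_prod_chart)
    show "cmap ?k ` cdom ?k \<subseteq> cimg ?k" by (simp add: cimg_def)
    show "cinv ?k ` cimg ?k \<subseteq> cdom ?k"
      using assms by (auto simp: cimg_prod_chart inv cinv_in_cdom)
    show "cinv ?k (cmap ?k x) = x" if "x \<in> cdom ?k" for x
      using that assms by (auto simp: inv cmap_in_cimg cinv_cmap)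
    show "cmap ?k (cinv ?k y) = y" if "y \<in> cimg ?k" for y
      using that assms by (auto simp: cimg_prod_chart inv cmap_cinv)
  qed
  then show ?thesis
    using c d by (auto simp: is_chart_def cimg_prod_chart open_Times)
qed


section \<open>Vertical vectors and projected vector fields\<close>

text \<open>In a local trivialisation the vector has the form \<open>(0, w)\<close>; the curve is the preimage of a
  straight line with direction \<open>w\<close> in a chart of the typical fibre.\<close>

lemma vertical_tangent_to_fibre:
  fixes P :: "('p::{t2_space, second_countable_topology}, 'e::fin_dim_inner) chart set"
    and M :: "('m::{t2_space, second_countable_topology}, 'b::fin_dim_inner) chart set"
    and F :: "('f::{t2_space, second_countable_topology}, 'g::fin_dim_inner) chart set"
  assumes P: "smooth_manifold P" and M: "smooth_manifold M" and F: "smooth_manifold F"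
    and fibred: "fibre_bundle P M F \<pi>"
    and v: "v \<in> tangent_space P p" and vertical: "tangent_map P M \<pi> v = (\<pi> p, \<lambda>_. 0)"
  shows "v \<in> tangent_to P (\<pi> -` {\<pi> p}) p"
proof -
  have smooth_\<pi>: "smooth_map P M \<pi>" using fibred by (simp add: fibre_bundle_def)
  obtain U \<Phi> where U: "open U" "\<pi> p \<in> U" and bij: "bij_betw \<Phi> (\<pi> -` U) (U \<times> UNIV)"
    and fst_\<Phi>: "\<And>q. q \<in> \<pi> -` U \<Longrightarrow> fst (\<Phi> q) = \<pi> q"
    and smooth_\<Phi>: "smooth_map_on P (prod_atlas M F) (\<pi> -` U) \<Phi>"
    and smooth_inv: "smooth_map_on (prod_atlas M F) P (U \<times> UNIV) (inv_into (\<pi> -` U) \<Phi>)"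
    using fibred unfolding fibre_bundle_def by meson
  define S where "S = \<pi> -` U"
  define \<Psi> where "\<Psi> = inv_into S \<Phi>"
  have "open S"
    using smooth_\<pi> U(1) by (simp add: S_def smooth_map_on_def open_vimage)
  have "p \<in> S" using U by (simp add: S_def)
  have \<Psi>_\<Phi>: "\<Psi> (\<Phi> q) = q" if "q \<in> S" for q
    using that bij by (simp add: \<Psi>_def S_def bij_betw_def)
  have \<Phi>_\<Psi>: "\<Phi> (\<Psi> z) = z" "\<Psi> z \<in> S" if "fst z \<in> U" for z
  proof -
    have "z \<in> \<Phi> ` S" using that bij by (simp add: S_def bij_betw_def mem_Times_iff)
    then show "\<Phi> (\<Psi> z) = z" "\<Psi> z \<in> S"
      by (simp_all add: \<Psi>_def f_inv_into_f inv_into_into)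
  qed
  have open_UF: "open (U \<times> (UNIV :: 'f set))" using U(1) by (simp add: open_Times)
  note smooth_\<Phi> = smooth_\<Phi>[folded S_def] and smooth_\<Psi> = smooth_inv[folded S_def \<Psi>_def]
  define c where "c = chart_at P p"
  define d where "d = chart_at M (\<pi> p)"
  define e where "e = chart_at F (snd (\<Phi> p))"
  have c: "c \<in> P" "p \<in> cdom c" "is_chart c"
    using chart_at[OF P] manifold_chart[OF P] by (simp_all add: c_def)
  have d: "d \<in> M" "\<pi> p \<in> cdom d" "is_chart d"
    using chart_at[OF M] manifold_chart[OF M] by (simp_all add: d_def)
  have e: "e \<in> F" "snd (\<Phi> p) \<in> cdom e" "is_chart e"
    using chart_at[OF F] manifold_chart[OF F] by (simp_all add: e_def)
  \<comment> \<open>In this chart around \<Phi> p, fibres appear as slices with constant first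
    component.\<close>
  define k where "k = prod_chart d e"
  have \<Phi>p: "\<Phi> p = (\<pi> p, snd (\<Phi> p))"
    using fst_\<Phi>[of p] \<open>p \<in> S\<close> by (metis S_def prod.collapse)
  have "k \<in> prod_atlas M F"
    using d(1) e(1) unfolding k_def prod_atlas_def by force
  moreover have "is_chart k" unfolding k_def by (rule is_chart_prod_chart[OF d(3) e(3)])
  moreover have "\<Phi> p \<in> cdom k"
    by (subst \<Phi>p) (simp add: k_def d e)
  ultimately have k: "k \<in> prod_atlas M F" "\<Phi> p \<in> cdom k" "is_chart k" by auto
  let ?a = "snd v c"
  define b where "b = chart_deriv c k \<Phi> p ?a"
  \<comment> \<open>The first component of \<Phi> is \<pi> near \<open>p\<close>, so
    \<open>fst b\<close> is the coordinate of T\<pi> v in \<open>d\<close>, which vanishes.\<close>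
  have fst_b: "fst b = 0"
  proof -
    let ?G = "cmap k \<circ> \<Phi> \<circ> cinv c"
    have "?G differentiable (at (cmap c p))"
      by (rule smooth_map_on_differentiable[OF smooth_\<Phi> \<open>p \<in> S\<close> c(1,2) k(1,2)])
    then have "((\<lambda>y. fst (?G y)) has_derivative (\<lambda>h. fst (chart_deriv c k \<Phi> p h))) (at (cmap c p))"
      unfolding chart_deriv_def frechet_derivative_works by (rule has_derivative_fst)
    then have "frechet_derivative (\<lambda>y. fst (?G y)) (at (cmap c p)) ?a = fst b"
      by (simp add: frechet_derivative_eqI b_def)
    moreover have "frechet_derivative (cmap d \<circ> \<pi> \<circ> cinv c) (at (cmap c p))
        = frechet_derivative (\<lambda>y. fst (?G y)) (at (cmap c p))"
      by (rule frechet_derivative_cong_open[OF open_cmap_image[OF c(3) \<open>open S\<close>]])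
        (use c \<open>p \<in> S\<close> fst_\<Phi> in \<open>auto simp: cinv_cmap k_def S_def\<close>)
    moreover have "chart_deriv c d \<pi> p ?a = 0"
      using snd_tangent_map[OF P smooth_\<pi> _ v c(1,2) d(1,2)] vertical by simp
    ultimately show ?thesis by (simp add: chart_deriv_def)
  qed
  \<comment> \<open>\<Psi> undoes \<Phi> near \<open>p\<close>, so its derivative carries
    \<open>b\<close> back to the coordinates of \<open>v\<close>.\<close>
  have \<Psi>_b: "chart_deriv k c \<Psi> (\<Phi> p) b = ?a"
  proof -
    have "chart_deriv c c (\<Psi> \<circ> \<Phi>) p = chart_deriv k c \<Psi> (\<Phi> p) \<circ> chart_deriv c k \<Phi> p"
      using smooth_\<Phi> \<open>open S\<close> \<open>p \<in> S\<close> c k smooth_\<Psi> U \<Psi>_\<Phi> \<Phi>p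
      by (intro chart_deriv_comp[of P "prod_atlas M F" S \<Phi> p c k P "U \<times> UNIV" \<Psi> c])
        (simp_all add: mem_Times_iff fst_\<Phi> S_def)
    moreover have "chart_deriv c c (\<Psi> \<circ> \<Phi>) p = chart_deriv c c id p"
      by (rule chart_deriv_cong_open[OF c(3,2) \<open>open S\<close> \<open>p \<in> S\<close>]) (simp add: \<Psi>_\<Phi>)
    ultimately show ?thesis
      using chart_deriv_id[OF c(3,2)] by (simp add: b_def fun_eq_iff)
  qed
  define y where "y = cmap k (\<Phi> p)"
  define ray where "ray t = y + t *\<^sub>R b" for t :: real
  have y: "y \<in> cimg k" by (simp add: y_def cmap_in_cimg[OF k(2)])
  have ray_cont: "continuous_on UNIV ray"
    unfolding ray_def by (intro continuous_intros)
  \<comment> \<open>The image of the chart is open, so the line stays in it for small parameters;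
    this is the origin of \<epsilon>.\<close>
  have "open (ray -` cimg k)"
    using k(3) ray_cont by (auto simp: is_chart_def open_vimage)
  moreover have "0 \<in> ray -` cimg k" using y by (simp add: ray_def)
  ultimately obtain \<epsilon> where \<epsilon>: "\<epsilon> > 0" "ball 0 \<epsilon> \<subseteq> ray -` cimg k"
    unfolding open_contains_ball by blast
  define I where "I = {-\<epsilon><..<\<epsilon>}"
  have I: "open I" "0 \<in> I" using \<epsilon>(1) by (auto simp: I_def)
  have ray_cimg: "ray t \<in> cimg k" if "t \<in> I" for t
    using that \<epsilon>(2) by (auto simp: I_def subset_eq dist_real_def)
  \<comment> \<open>Because \<open>fst b = 0\<close>, the base coordinate does not move along the
    line; this keeps the curve in the fibre.\<close>
  have fst_ray: "fst (cinv k (ray t)) = \<pi> p" if "t \<in> I" for t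
  proof -
    have "fst (ray t) = cmap d (\<pi> p)"
      using fst_b \<Phi>p by (simp add: ray_def y_def k_def) (metis fst_conv fst_map_prod)
    moreover have "ray t \<in> cimg d \<times> cimg e"
      using ray_cimg[OF that] unfolding k_def by (simp only: cimg_prod_chart)
    moreover have "ray t = (fst (ray t), snd (ray t))" by simp
    ultimately show ?thesis
      using cinv_prod_chart[OF d(3) e(3)] cinv_cmap[OF d(3,2)]
      by (metis SigmaE fst_conv k_def)
  qed
  define \<gamma> where "\<gamma> t = \<Psi> (cinv k (ray t))" for t
  have \<gamma>_fibre: "\<pi> (\<gamma> t) = \<pi> p" if "t \<in> I" for t
    using \<Phi>_\<Psi>[of "cinv k (ray t)"] fst_ray[OF that] fst_\<Phi> U(2) by (metis S_def \<gamma>_def)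
  have \<gamma>0: "\<gamma> 0 = p"
    using k \<open>p \<in> S\<close> by (simp add: \<gamma>_def ray_def y_def cinv_cmap \<Psi>_\<Phi>)
  have \<gamma>_cont: "continuous_on I \<gamma>"
  proof -
    have "continuous_on (U \<times> UNIV) \<Psi>" using smooth_\<Psi> by (simp add: smooth_map_on_def)
    moreover have "continuous_on I (\<lambda>t. cinv k (ray t))"
      using k(3) ray_cimg
      by (intro continuous_on_compose2[OF _ continuous_on_subset[OF ray_cont]])
        (auto simp: is_chart_def homeomorphism_def)
    moreover have "(\<lambda>t. cinv k (ray t)) ` I \<subseteq> U \<times> UNIV"
      using fst_ray U(2) by (intro image_subsetI) (simp add: mem_Times_iff)
    ultimately show ?thesis unfolding \<gamma>_def by (rule continuous_on_compose2)
  qed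
  have smooth_\<gamma>: "smooth_map_on std_atlas P I \<gamma>"
  proof -
    \<comment> \<open>The only chart of the reals is the identity, so the coordinate form of
      \<gamma> in \<open>c'\<close> is that of \<Psi> composed with the line.\<close>
    have "smooth_on (I \<inter> \<gamma> -` cdom c') (\<lambda>t. (cmap c' \<circ> \<Psi> \<circ> cinv k) (ray t))" if "c' \<in> P" for c'
    proof (rule smooth_on_compose[where f = ray])
      show "open (I \<inter> \<gamma> -` cdom c')"
        by (rule open_smooth_map_domain[OF I(1) \<gamma>_cont manifold_chart[OF P that]])
      show "smooth_on (cmap k ` (cdom k \<inter> (U \<times> UNIV) \<inter> \<Psi> -` cdom c')) (cmap c' \<circ> \<Psi> \<circ> cinv k)"
        using smooth_\<Psi> k(1) that by (simp add: smooth_map_on_def)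
      show "smooth_on (I \<inter> \<gamma> -` cdom c') ray"
        unfolding ray_def by (rule smooth_on_affine)
      show "ray ` (I \<inter> \<gamma> -` cdom c') \<subseteq> cmap k ` (cdom k \<inter> (U \<times> UNIV) \<inter> \<Psi> -` cdom c')"
      proof (rule image_subsetI)
        fix t assume t: "t \<in> I \<inter> \<gamma> -` cdom c'"
        then have "cinv k (ray t) \<in> cdom k \<inter> (U \<times> UNIV) \<inter> \<Psi> -` cdom c'"
          using cinv_in_cdom[OF k(3) ray_cimg] fst_ray U(2) by (simp add: \<gamma>_def mem_Times_iff)
        moreover have "ray t = cmap k (cinv k (ray t))"
          using t by (simp add: cmap_cinv[OF k(3) ray_cimg])
        ultimately show "ray t \<in> cmap k ` (cdom k \<inter> (U \<times> UNIV) \<inter> \<Psi> -` cdom c')"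
          by (rule rev_image_eqI)
      qed
    qed
    then show ?thesis
      using \<gamma>_cont by (simp add: smooth_map_on_def std_atlas_def cinv_std o_def \<gamma>_def)
  qed
  let ?s = "Chart UNIV id :: (real, real) chart"
  let ?t = "coord_tvec std_atlas ?s 0 1"
  have s: "?s \<in> std_atlas" "0 \<in> cdom ?s" by (simp_all add: std_atlas_def)
  have t: "?t \<in> tangent_space std_atlas 0"
    by (rule coord_tvec_in_tangent_space[OF smooth_manifold_std s])
  have velocity: "tangent_map std_atlas P \<gamma> ?t \<in> tangent_space P p"
    using tangent_map_in_tangent_space[OF smooth_manifold_std P smooth_\<gamma> I t] by (simp add: \<gamma>0)
  have "snd (tangent_map std_atlas P \<gamma> ?t) c = chart_deriv ?s c \<gamma> 0 1"
    using snd_tangent_map[OF smooth_manifold_std smooth_\<gamma> I(2) t s c(1)] c(2)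
      snd_coord_tvec[OF is_chart_std s] by (simp add: \<gamma>0)
  \<comment> \<open>Chain rule at 0: the derivative of the line sends 1 to \<open>b\<close>, and
    that of \<Psi> sends \<open>b\<close> to \<open>?a\<close>.\<close>
  also have "\<dots> = ?a"
  proof -
    let ?G = "cmap c \<circ> \<Psi> \<circ> cinv k"
    have "(ray has_derivative (\<lambda>h. h *\<^sub>R b)) (at 0)"
      unfolding ray_def by (auto intro!: derivative_eq_intros)
    moreover have "?G differentiable (at (ray 0))"
      using smooth_map_on_differentiable[OF smooth_\<Psi> _ k(1,2) c(1)] \<Phi>p U(2) c(2) \<Psi>_\<Phi>[OF \<open>p \<in> S\<close>]
      by (simp add: ray_def y_def mem_Times_iff fst_\<Phi> S_def)
    then have "(?G has_derivative chart_deriv k c \<Psi> (\<Phi> p)) (at (ray 0))"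
      by (simp add: frechet_derivative_works chart_deriv_def ray_def y_def)
    ultimately have "((?G \<circ> ray) has_derivative (chart_deriv k c \<Psi> (\<Phi> p) \<circ> (\<lambda>h. h *\<^sub>R b))) (at 0)"
      by (rule diff_chain_at)
    moreover have "cmap c \<circ> \<gamma> \<circ> cinv ?s = ?G \<circ> ray" by (auto simp: \<gamma>_def cinv_std)
    ultimately show ?thesis
      by (simp add: chart_deriv_def[of ?s] frechet_derivative_eqI \<Psi>_b)
  qed
  finally have "v = tangent_map std_atlas P \<gamma> ?t"
    using tangent_space_eqI[OF v velocity c(1,2)] by simp
  then show ?thesis
    unfolding tangent_to_def using \<epsilon>(1) smooth_\<gamma> \<gamma>_fibre \<gamma>0 unfolding I_def by blast
qed

text \<open>In coordinates the field is the derivative of \<open>?f\<close> at \<open>?g y\<close>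
  applied to \<open>?z (?g y)\<close>, where \<open>?f\<close>, \<open>?g\<close>, \<open>?z\<close>
  represent \<pi>, \<alpha> and Z; hence \<open>smooth_on_linear_apply\<close>. A chart of
  \<open>P\<close> covers the section only near a given point, so the argument is local around
  \<open>y0\<close>.\<close>

lemma vector_field_projection_along_section:
  assumes P: "smooth_manifold P" and M: "smooth_manifold M"
    and Z: "vector_field P Z" and \<pi>: "smooth_map P M \<pi>" and \<alpha>: "smooth_map M P \<alpha>"
    and right_inv: "\<And>m. \<pi> (\<alpha> m) = m"
  shows "vector_field M (tangent_map P M \<pi> \<circ> Z \<circ> \<alpha>)"
proof -
  have Z_tangent: "Z p \<in> tangent_space P p" for p using Z by (simp add: vector_field_def)
  have "smooth_on (cimg c) (\<lambda>y. snd (tangent_map P M \<pi> (Z (\<alpha> (cinv c y)))) c)" if c: "c \<in> M" for c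
  proof (rule smooth_on_local)
    note chart_c = manifold_chart[OF M c]
    fix y0 assume "y0 \<in> cimg c"
    define m0 where "m0 = cinv c y0"
    define d where "d = chart_at P (\<alpha> m0)"
    have d: "d \<in> P" "\<alpha> m0 \<in> cdom d" "is_chart d"
      using chart_at[OF P] manifold_chart[OF P] by (simp_all add: d_def)
    define V where "V = cdom c \<inter> (UNIV \<inter> \<alpha> -` cdom d)"
    have V: "q \<in> cdom c" "\<alpha> q \<in> cdom d" if "q \<in> V" for q using that by (auto simp: V_def)
    have open_V: "open (cmap c ` V)"
      unfolding V_def using \<alpha> d(3)
      by (intro open_cmap_image[OF chart_c] open_smooth_map_domain) (auto simp: smooth_map_on_def)
    have y0: "y0 \<in> cmap c ` V"
      using cmap_cinv[OF chart_c \<open>y0 \<in> cimg c\<close>] cinv_in_cdom[OF chart_c \<open>y0 \<in> cimg c\<close>] d(2)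
      by (intro image_eqI[of _ _ m0]) (auto simp: m0_def V_def)
    let ?f = "cmap c \<circ> \<pi> \<circ> cinv d" and ?g = "cmap d \<circ> \<alpha> \<circ> cinv c"
    let ?z = "\<lambda>y. snd (Z (cinv d y)) d"
    let ?T = "cmap d ` (cdom d \<inter> UNIV \<inter> \<pi> -` cdom c)"
    have smooth_f: "smooth_on ?T ?f" using \<pi> c d by (simp add: smooth_map_on_def)
    have "smooth_on (cmap c ` (cdom c \<inter> UNIV \<inter> \<alpha> -` cdom d)) ?g"
      using \<alpha> c d by (simp add: smooth_map_on_def)
    then have smooth_g: "smooth_on (cmap c ` V) ?g" by (simp add: V_def)
    \<comment> \<open>As \<pi> \<circ> \<alpha> is the identity, \<alpha> sends \<open>V\<close> to
      points where \<pi> can be read in the chart \<open>c\<close>.\<close>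
    have g_T: "?g ` cmap c ` V \<subseteq> ?T"
      using V right_inv by (auto simp: cinv_cmap[OF chart_c])
    have g_cimg: "?g ` cmap c ` V \<subseteq> cimg d"
      using V by (auto simp: cinv_cmap[OF chart_c] cmap_in_cimg)
    have "smooth_on (cmap c ` V) (\<lambda>y. frechet_derivative ?f (at (?g y)) (?z (?g y)))"
    proof (rule smooth_on_linear_apply[OF open_V,
          where G = "\<lambda>y. frechet_derivative ?f (at (?g y))" and z = "\<lambda>y. ?z (?g y)"])
      show "linear (frechet_derivative ?f (at (?g y)))" if "y \<in> cmap c ` V" for y
        using that g_T by (intro linear_frechet_derivative smooth_on_imp_differentiable[OF smooth_f]) blast
      show "smooth_on (cmap c ` V) (\<lambda>y. frechet_derivative ?f (at (?g y)) b)" for b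
        by (rule smooth_on_compose[OF open_V g_T smooth_g smooth_on_frechet_derivative[OF smooth_f]])
      have "smooth_on (cimg d) ?z" using Z d(1) by (simp add: vector_field_def)
      then show "smooth_on (cmap c ` V) (\<lambda>y. ?z (?g y))"
        by (rule smooth_on_compose[OF open_V g_cimg smooth_g])
    qed
    then have "smooth_on (cmap c ` V) (\<lambda>y. snd (tangent_map P M \<pi> (Z (\<alpha> (cinv c y)))) c)"
    proof (rule smooth_on_cong[OF open_V, rotated])
      fix y assume "y \<in> cmap c ` V"
      then obtain q where q: "q \<in> V" "y = cmap c q" by blast
      have "snd (tangent_map P M \<pi> (Z (\<alpha> q))) c = chart_deriv d c \<pi> (\<alpha> q) (snd (Z (\<alpha> q)) d)"
        using V[OF q(1)] right_inv c d by (intro snd_tangent_map[OF P \<pi> _ Z_tangent]) simp_all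
      then show "frechet_derivative ?f (at (?g y)) (?z (?g y))
          = snd (tangent_map P M \<pi> (Z (\<alpha> (cinv c y)))) c"
        using V[OF q(1)] by (simp add: q(2) chart_deriv_def cinv_cmap[OF chart_c] cinv_cmap[OF d(3)])
    qed
    then show "\<exists>T. open T \<and> y0 \<in> T \<and>
        smooth_on T (\<lambda>y. snd (tangent_map P M \<pi> (Z (\<alpha> (cinv c y)))) c)"
      using open_V y0 by blast
  qed
  moreover have "tangent_map P M \<pi> (Z (\<alpha> m)) \<in> tangent_space M m" for m
    using tangent_map_in_tangent_space[OF P M \<pi> open_UNIV UNIV_I Z_tangent] right_inv by metis
  ultimately show ?thesis by (simp add: vector_field_def)
qed

theorem theorem6:
  fixes P :: "('p::{t2_space, second_countable_topology}, 'e::fin_dim_inner) chart set"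
    and M :: "('m::{t2_space, second_countable_topology}, 'b::fin_dim_inner) chart set"
    and F :: "('f::{t2_space, second_countable_topology}, 'g::fin_dim_inner) chart set"
    and \<omega> :: "('p, 'e) form2"
    and H :: "'p \<Rightarrow> real"
    and Z :: "'p \<Rightarrow> ('p, 'e) tvec"
    and \<pi> :: "'p \<Rightarrow> 'm"
    and \<alpha> :: "'m \<Rightarrow> 'p"
    and X :: "'m \<Rightarrow> ('m, 'b) tvec"
  assumes "smooth_manifold P" and "smooth_manifold M" and "smooth_manifold F"
    and "symplectic_form P \<omega>"
    and "smooth_function P H"
    and "hamiltonian_vector_field P \<omega> H Z"
    and "fibre_bundle P M F \<pi>"
    and "smooth_section P M \<pi> \<alpha>"
    and "X = tangent_map P M \<pi> \<circ> Z \<circ> \<alpha>"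
    and "\<forall>x. isotropic_submanifold P \<omega> (\<pi> -` {x})"
  shows "slicing_section P M \<pi> Z \<alpha> \<longleftrightarrow>
    (\<forall>u\<in>tangent_bundle M.
       interior_product X (pullback M P \<alpha> \<omega>) u - differential M (H \<circ> \<alpha>) u = 0)"
proof -
  note P = assms(1) and M = assms(2) and X = assms(9)
  let ?T\<alpha> = "tangent_map M P \<alpha>" and ?T\<pi> = "tangent_map P M \<pi>"
  have \<omega>: "two_form P \<omega>" "nondegenerate P \<omega>"
    using assms(4) by (simp_all add: symplectic_form_def)
  have Z: "vector_field P Z" using assms(6) by (simp add: hamiltonian_vector_field_def)
  have dH: "\<omega> (Z p) u = differential P H u" if "u \<in> tangent_space P p" for p u
    using assms(6) that tangent_space_fst[OF that]
    unfolding hamiltonian_vector_field_def interior_product_def tangent_bundle_def by blast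
  have Z_tangent: "Z p \<in> tangent_space P p" for p using Z by (simp add: vector_field_def)
  have \<pi>: "smooth_map P M \<pi>" using assms(7) by (simp add: fibre_bundle_def)
  have \<alpha>: "smooth_map M P \<alpha>" and right_inv: "\<pi> \<circ> \<alpha> = id"
    using assms(8) by (simp_all add: smooth_section_def)
  have section_at: "\<pi> (\<alpha> m) = m" for m using right_inv by (metis comp_apply id_apply)
  have T\<alpha>: "?T\<alpha> u \<in> tangent_space P (\<alpha> m)" if "u \<in> tangent_space M m" for u m
    using tangent_map_in_tangent_space[OF M P \<alpha> _ _ that] by simp
  have T\<pi>: "?T\<pi> v \<in> tangent_space M m" if "v \<in> tangent_space P (\<alpha> m)" for v m
    using tangent_map_in_tangent_space[OF P M \<pi> _ _ that] by (simp add: section_at)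
  have T\<pi>_T\<alpha>: "?T\<pi> (?T\<alpha> u) = u" if "u \<in> tangent_space M m" for u m
    using tangent_map_comp[OF M P \<alpha> \<pi>, of u] tangent_map_id[OF M that] by (simp add: right_inv)
  have X_field: "vector_field M X"
    unfolding X by (rule vector_field_projection_along_section[OF P M Z \<pi> \<alpha> section_at])
  have X_tangent: "X m \<in> tangent_space M m" for m using X_field by (simp add: vector_field_def)
  \<comment> \<open>Combines d(H \<circ> \<alpha>) u = dH(T\<alpha> u) with the defining property of
    Z, applied to the vector T\<alpha> u.\<close>
  have equation: "interior_product X (pullback M P \<alpha> \<omega>) u - differential M (H \<circ> \<alpha>) u
      = \<omega> (?T\<alpha> (X m)) (?T\<alpha> u) - \<omega> (Z (\<alpha> m)) (?T\<alpha> u)"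
    if "u \<in> tangent_space M m" for u m
    using that dH[OF T\<alpha>[OF that]] differential_comp[OF M P \<alpha> assms(5), of u]
    by (simp add: interior_product_def pullback_def tangent_space_fst)
  \<comment> \<open>Used twice: for Z - T\<alpha> X, and for the difference between a vector
    \<open>v\<close> and T\<alpha> (T\<pi> v).\<close>
  have vertical: "tvec_diff a b \<in> tangent_to P (\<pi> -` {m}) (\<alpha> m)"
    if "a \<in> tangent_space P (\<alpha> m)" "b \<in> tangent_space P (\<alpha> m)" "?T\<pi> a = ?T\<pi> b" for a b m
  proof -
    have "?T\<pi> (tvec_diff a b) = tvec_diff (?T\<pi> a) (?T\<pi> b)"
      by (rule tangent_map_diff[OF P \<pi> that(1,2)])
    also have "\<dots> = (m, \<lambda>_. 0)"
      using that(3) tvec_diff_eq_zero_iff[OF T\<pi>[OF that(1)] T\<pi>[OF that(2)]] by simp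
    finally show ?thesis
      using vertical_tangent_to_fibre[OF P M assms(3,7) tvec_diff_in_tangent_space[OF P that(1,2)]]
      by (simp add: section_at)
  qed
  show ?thesis
  proof
    assume "slicing_section P M \<pi> Z \<alpha>"
    then obtain Y where Y: "vector_field M Y" "?T\<alpha> \<circ> Y = Z \<circ> \<alpha>"
      by (auto simp: slicing_section_def)
    \<comment> \<open>Every witness \<open>Y\<close> equals X: apply T\<pi> to T\<alpha> \<circ> Y =
      Z \<circ> \<alpha>.\<close>
    have "?T\<alpha> (X m) = Z (\<alpha> m)" for m
    proof -
      have "Y m \<in> tangent_space M m" using Y(1) by (simp add: vector_field_def)
      moreover have "?T\<alpha> (Y m) = Z (\<alpha> m)" using Y(2) by (metis comp_apply)
      ultimately show ?thesis using T\<pi>_T\<alpha> by (metis X comp_apply)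
    qed
    then show "\<forall>u\<in>tangent_bundle M.
        interior_product X (pullback M P \<alpha> \<omega>) u - differential M (H \<circ> \<alpha>) u = 0"
      using equation by (auto simp: tangent_bundle_def)
  next
    assume eq: "\<forall>u\<in>tangent_bundle M.
        interior_product X (pullback M P \<alpha> \<omega>) u - differential M (H \<circ> \<alpha>) u = 0"
    have "?T\<alpha> (X m) = Z (\<alpha> m)" for m
    proof -
      let ?p = "\<alpha> m"
      note Xm = T\<alpha>[OF X_tangent, of m]
      let ?D = "tvec_diff (Z ?p) (?T\<alpha> (X m))"
      have D: "?D \<in> tangent_space P ?p"
        by (rule tvec_diff_in_tangent_space[OF P Z_tangent Xm])
      \<comment> \<open>T\<pi> sends both vectors to \<open>X m\<close>: the first by the definition
        of X, the second because T\<pi> undoes T\<alpha>.\<close>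
      have D_vertical: "?D \<in> tangent_to P (\<pi> -` {m}) ?p"
        using T\<pi>_T\<alpha>[OF X_tangent] by (intro vertical[OF Z_tangent Xm]) (simp add: X)
      have "\<omega> ?D v = 0" if v: "v \<in> tangent_space P ?p" for v
      proof -
        \<comment> \<open>The component of \<open>v\<close> along the section. It has the same image
          under T\<pi> as \<open>v\<close>, so the rest is vertical.\<close>
        let ?h = "?T\<alpha> (?T\<pi> v)"
        note h = T\<alpha>[OF T\<pi>[OF v]]
        have "tvec_diff v ?h \<in> tangent_to P (\<pi> -` {m}) ?p"
          using T\<pi>_T\<alpha>[OF T\<pi>[OF v]] by (intro vertical[OF v h]) simp
        then have "\<omega> ?D (tvec_diff v ?h) = 0"
          using assms(10) D_vertical section_at by (auto simp: isotropic_submanifold_def)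
        \<comment> \<open>The assumed equation at u = T\<pi> v, for which T\<alpha> u is
          \<open>?h\<close>.\<close>
        moreover have "\<omega> ?D ?h = 0"
          using equation[OF T\<pi>[OF v]] eq T\<pi>[OF v] two_form_diff(1)[OF P \<omega>(1) Z_tangent Xm h]
          by (auto simp: tangent_bundle_def)
        ultimately show ?thesis
          using two_form_diff(2)[OF P \<omega>(1) v h D] by simp
      qed
      then have "?D = (?p, \<lambda>_. 0)"
        using \<omega>(2) D by (auto simp: nondegenerate_def)
      then show ?thesis
        using tvec_diff_eq_zero_iff[OF Z_tangent Xm] by simp
    qed
    then have "?T\<alpha> \<circ> X = Z \<circ> \<alpha>" by (intro ext) simp
    then show "slicing_section P M \<pi> Z \<alpha>"
      unfolding slicing_section_def using assms(8) X_field by blast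
  qed
qed

end
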